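(* Let $S$ be an integral domain that satisfies the ACCP and whose quotient field is $F$, and let $F\subseteq K$ be a field extension. Then the following statements hold. (1) The subring $F[x]+K[x]x^2$ of $K[x]$ satisfies the ACCP and so is atomic. (2) The subring $S[x]+F[x]x^2$ of $F[x]$ is almost atomic. (3) The subring $S[x]+K[x]x^2$ of $K[x]$ is quasi-atomic.
   Context: For an integral domain $D$, an atom is a nonzero nonunit $a$ such that $a=bc$ with $b,c\in D$ implies that $b$ or $c$ is a unit. A nonzero element of $D$ is atomic if it is a unit or a product of finitely many atoms. $D$ is atomic if all its nonzero elements are atomic; $D$ is almost atomic (resp., quasi-atomic) if for each nonzero $b\in D$ there is an atomic element $a\in D$ (resp., a nonzero element $a\in D$) such that $ab$ is atomic. $D$ satisfies the ACCP if every ascending chain of principal ideals stabilizes. For subrings $A\subseteq B$ of a field, $A[x]+B[x]x^2$ is the ring of polynomials over $B$ whose coefficients of degrees $0$ and $1$ lie in $A$. *)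

theory Defs
  imports "HOL-Algebra.Polynomials"
begin

text \<open>
  The notions of atomicity are stated for a ring \<open>D\<close> in the sense of HOL-Algebra; they are meant
  for integral domains. Atoms are the elements of \<open>carrier D\<close> that satisfy
  \<^const>\<open>ring_irreducible\<close>; lemma \<open>atoms_iff\<close> shows that in a domain these are the nonzero
  nonunits \<open>a\<close> such that \<open>a = b c\<close> implies that \<open>b\<close> or \<open>c\<close> is a unit.
\<close>

definition atoms :: "('a, 'b) ring_scheme \<Rightarrow> 'a set"
  where "atoms D = {a \<in> carrier D. ring_irreducible\<^bsub>D\<^esub> a}"

definition atomic_element :: "('a, 'b) ring_scheme \<Rightarrow> 'a \<Rightarrow> bool"
  where "atomic_element D a \<longleftrightarrow>
    a \<in> carrier D - {\<zero>\<^bsub>D\<^esub>} \<and>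
    (a \<in> Units D \<or> (\<exists>ps. set ps \<subseteq> atoms D \<and> a = foldr (\<otimes>\<^bsub>D\<^esub>) ps \<one>\<^bsub>D\<^esub>))"

definition atomic_ring :: "('a, 'b) ring_scheme \<Rightarrow> bool"
  where "atomic_ring D \<longleftrightarrow> (\<forall>a \<in> carrier D - {\<zero>\<^bsub>D\<^esub>}. atomic_element D a)"

definition almost_atomic :: "('a, 'b) ring_scheme \<Rightarrow> bool"
  where "almost_atomic D \<longleftrightarrow>
    (\<forall>b \<in> carrier D - {\<zero>\<^bsub>D\<^esub>}.
      \<exists>a \<in> carrier D. atomic_element D a \<and> atomic_element D (a \<otimes>\<^bsub>D\<^esub> b))"

definition quasi_atomic :: "('a, 'b) ring_scheme \<Rightarrow> bool"
  where "quasi_atomic D \<longleftrightarrow>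
    (\<forall>b \<in> carrier D - {\<zero>\<^bsub>D\<^esub>}.
      \<exists>a \<in> carrier D - {\<zero>\<^bsub>D\<^esub>}. atomic_element D (a \<otimes>\<^bsub>D\<^esub> b))"

definition ACCP :: "('a, 'b) ring_scheme \<Rightarrow> bool"
  where "ACCP D \<longleftrightarrow>
    (\<forall>I :: nat \<Rightarrow> 'a set.
      (\<forall>n. principalideal (I n) D) \<and> (\<forall>n. I n \<subseteq> I (Suc n)) \<longrightarrow>
      (\<exists>N. \<forall>n \<ge> N. I n = I N))"

text \<open>
  The quotient field of a subdomain \<open>S\<close> of a field \<open>R\<close>, realised inside \<open>R\<close>.
\<close>

definition quotient_field :: "('a, 'b) ring_scheme \<Rightarrow> 'a set \<Rightarrow> 'a set"
  where "quotient_field R S = {a \<otimes>\<^bsub>R\<^esub> inv\<^bsub>R\<^esub> b | a b. a \<in> S \<and> b \<in> S - {\<zero>\<^bsub>R\<^esub>}}"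

text \<open>
  \<open>A[x] + B[x]x\<^sup>2\<close> for subrings \<open>A \<subseteq> B\<close> of \<open>R\<close>, as a substructure of the polynomial ring \<open>B[x]\<close>.
  The function \<open>ring.coeff R p\<close> indexes coefficients by their degree, although \<^const>\<open>univ_poly\<close>
  represents polynomials as lists with the leading coefficient first.
\<close>

definition composite_poly_ring :: "('a, 'b) ring_scheme \<Rightarrow> 'a set \<Rightarrow> 'a set \<Rightarrow> 'a list ring"
  where "composite_poly_ring R A B =
    (B [X]\<^bsub>R\<^esub>)\<lparr>carrier := {p \<in> carrier (B [X]\<^bsub>R\<^esub>). ring.coeff R p 0 \<in> A \<and> ring.coeff R p 1 \<in> A}\<rparr>"

lemma (in domain) atoms_iff:
  "a \<in> atoms R \<longleftrightarrow>
    a \<in> carrier R - {\<zero>} \<and> a \<notin> Units R \<and>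
    (\<forall>b \<in> carrier R. \<forall>c \<in> carrier R. a = b \<otimes> c \<longrightarrow> b \<in> Units R \<or> c \<in> Units R)"
proof
  assume "a \<in> atoms R"
  then have "a \<in> carrier R" and irr: "ring_irreducible a" by (auto simp: atoms_def)
  then show "a \<in> carrier R - {\<zero>} \<and> a \<notin> Units R \<and>
    (\<forall>b \<in> carrier R. \<forall>c \<in> carrier R. a = b \<otimes> c \<longrightarrow> b \<in> Units R \<or> c \<in> Units R)"
    using ring_irreducibleE[of a] by blast
next
  assume *: "a \<in> carrier R - {\<zero>} \<and> a \<notin> Units R \<and>
    (\<forall>b \<in> carrier R. \<forall>c \<in> carrier R. a = b \<otimes> c \<longrightarrow> b \<in> Units R \<or> c \<in> Units R)"
  then have "ring_irreducible a"
    by (intro ring_irreducibleI) auto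
  with * show "a \<in> atoms R" by (auto simp: atoms_def)
qed

lemma (in field) quotient_field_subfield:
  assumes "subdomain S R"
  shows "subfield (quotient_field R S) R" and "S \<subseteq> quotient_field R S"
proof -
  note S = subdomainE[OF assms]
  have inv_in: "inv b \<in> carrier R - {\<zero>}" if "b \<in> S - {\<zero>}" for b
    using that S(1) field_Units Units_inv_Units by blast
  have inv_mult: "b \<otimes> inv b = \<one>" if "b \<in> S - {\<zero>}" for b
    using that S(1) field_Units by (intro Units_r_inv) blast
  have frac: "a \<otimes> inv b \<in> quotient_field R S" if "a \<in> S" "b \<in> S - {\<zero>}" for a b
    using that unfolding quotient_field_def by blast
  have prod_in: "b \<otimes> d \<in> S - {\<zero>}" if "b \<in> S - {\<zero>}" "d \<in> S - {\<zero>}" for b d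
    using that S(1,6) integral by blast
  have fracI: "z \<in> quotient_field R S"
    if "z \<in> carrier R" "z \<otimes> b \<in> S" "b \<in> S - {\<zero>}" for z b
  proof -
    have "z = (z \<otimes> b) \<otimes> inv b"
      using that inv_in inv_mult S(1) by (subst m_assoc) auto
    then show ?thesis using frac[of "z \<otimes> b" b] that by simp
  qed
  have fracE: "\<exists>b \<in> S - {\<zero>}. z \<otimes> b \<in> S \<and> z \<in> carrier R" if "z \<in> quotient_field R S" for z
  proof -
    from that obtain a b where ab: "a \<in> S" "b \<in> S - {\<zero>}" "z = a \<otimes> inv b"
      unfolding quotient_field_def by blast
    then have "z \<otimes> b = a"
      using inv_in[of b] inv_mult[of b] S(1) by (simp add: m_assoc m_comm[of "inv b"] subset_iff)
    then show ?thesis using ab inv_in[of b] S(1) by (intro bexI[of _ b]) auto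
  qed
  have one: "\<one> \<in> S - {\<zero>}" using S(3) by auto
  show sub: "S \<subseteq> quotient_field R S"
    using S(1) one by (auto intro!: fracI[of _ \<one>])
  have cring: "subcring (quotient_field R S) R"
  proof (intro subcringI' subringI)
    show "quotient_field R S \<subseteq> carrier R" using fracE by blast
    show "\<one> \<in> quotient_field R S" using sub one by blast
  next
    fix h assume "h \<in> quotient_field R S"
    then obtain b where b: "b \<in> S - {\<zero>}" "h \<otimes> b \<in> S" "h \<in> carrier R" using fracE by blast
    then show "\<ominus> h \<in> quotient_field R S"
      using S(1,5) by (intro fracI[of _ b]) (auto simp: l_minus subset_iff)
  next
    fix h k assume "h \<in> quotient_field R S" "k \<in> quotient_field R S"
    then obtain b d where b: "b \<in> S - {\<zero>}" "h \<otimes> b \<in> S" "h \<in> carrier R"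
      and d: "d \<in> S - {\<zero>}" "k \<otimes> d \<in> S" "k \<in> carrier R" using fracE by meson
    have car: "b \<in> carrier R" "d \<in> carrier R" using b d S(1) by auto
    have "(h \<otimes> k) \<otimes> (b \<otimes> d) = (h \<otimes> b) \<otimes> (k \<otimes> d)"
      using b(3) d(3) car by (simp add: m_ac)
    then have "(h \<otimes> k) \<otimes> (b \<otimes> d) \<in> S" using b d S(6) by simp
    then show "h \<otimes> k \<in> quotient_field R S"
      using b d prod_in by (intro fracI[of _ "b \<otimes> d"]) auto
    have "(h \<oplus> k) \<otimes> (b \<otimes> d) = (h \<otimes> b) \<otimes> d \<oplus> (k \<otimes> d) \<otimes> b"
      using b(3) d(3) car by (simp add: l_distr r_distr m_ac)
    then have "(h \<oplus> k) \<otimes> (b \<otimes> d) \<in> S" using b d S(6,7) by simp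
    then show "h \<oplus> k \<in> quotient_field R S"
      using b d prod_in by (intro fracI[of _ "b \<otimes> d"]) auto
  qed
  show "subfield (quotient_field R S) R"
  proof (rule subfieldI[OF cring], rule subset_antisym)
    show "Units (R\<lparr>carrier := quotient_field R S\<rparr>) \<subseteq> quotient_field R S - {\<zero>}"
    proof
      fix u assume u: "u \<in> Units (R\<lparr>carrier := quotient_field R S\<rparr>)"
      then obtain v where "v \<in> quotient_field R S" "u \<otimes> v = \<one>" "u \<in> quotient_field R S"
        unfolding Units_def by auto
      moreover have "\<zero> \<otimes> v \<noteq> \<one>" using fracE \<open>v \<in> quotient_field R S\<close> by force
      ultimately show "u \<in> quotient_field R S - {\<zero>}" by auto
    qed
    show "quotient_field R S - {\<zero>} \<subseteq> Units (R\<lparr>carrier := quotient_field R S\<rparr>)"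
    proof
      fix u assume u: "u \<in> quotient_field R S - {\<zero>}"
      then obtain b where b: "b \<in> S - {\<zero>}" "u \<otimes> b \<in> S" "u \<in> carrier R" using fracE by blast
      have U: "u \<in> Units R" using u b(3) field_Units by auto
      have nz: "u \<otimes> b \<in> S - {\<zero>}" using integral[of u b] b u S(1) by auto
      have "inv u \<otimes> (u \<otimes> b) = b"
        using U b S(1) by (subst m_assoc[symmetric]) auto
      then have "inv u \<in> quotient_field R S"
        using U nz b by (intro fracI[of _ "u \<otimes> b"]) auto
      then show "u \<in> Units (R\<lparr>carrier := quotient_field R S\<rparr>)"
        using u U unfolding Units_def[of "R\<lparr>carrier := quotient_field R S\<rparr>"]
        by (auto intro!: bexI[of _ "inv u"])
    qed
  qed
qed

lemma (in domain) composite_poly_ring_subring: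
  assumes A: "subring A R" and B: "subring B R"
  shows "subring (carrier (composite_poly_ring R A B)) (B [X])"
    and "domain (composite_poly_ring R A B)"
proof -
  interpret BX: domain "B [X]" using univ_poly_is_domain[OF B] .
  note a = subringE[OF A]
  let ?C = "{p \<in> carrier (B [X]). coeff p 0 \<in> A \<and> coeff p 1 \<in> A}"
  have set_car: "set p \<subseteq> carrier R" if "p \<in> carrier (B [X])" for p
    using that subringE(1)[OF B] by (auto simp: univ_poly_def polynomial_def)
  have sub: "subring ?C (B [X])"
  proof (rule BX.subringI)
    show "?C \<subseteq> carrier (B [X])" by blast
    show "\<one>\<^bsub>B [X]\<^esub> \<in> ?C"
      using BX.one_closed a(2,3) by (auto simp: univ_poly_one)
  next
    fix p assume p: "p \<in> ?C"
    then have c: "coeff (\<ominus>\<^bsub>B [X]\<^esub> p) = (\<lambda>i. \<ominus> \<one> \<otimes> coeff p i)"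
    proof -
      have eq: "map (\<lambda>x. \<ominus> x) p = map (\<lambda>x. \<ominus> \<one> \<otimes> x) p"
        using set_car[of p] p by (auto simp: l_minus subset_iff)
      then show ?thesis
        using p univ_poly_a_inv_def'[OF B, of p] scalar_coeff[of "\<ominus> \<one>" p] unfolding eq by simp
    qed
    then show "\<ominus>\<^bsub>B [X]\<^esub> p \<in> ?C"
      using p a by auto
  next
    fix p q assume p: "p \<in> ?C" and q: "q \<in> ?C"
    have add: "coeff (p \<oplus>\<^bsub>B [X]\<^esub> q) = (\<lambda>i. coeff p i \<oplus> coeff q i)"
      using p q set_car poly_add_coeff[of p q] by (simp add: univ_poly_add)
    then show "p \<oplus>\<^bsub>B [X]\<^esub> q \<in> ?C"
      using p q a(7) by simp
    have mult: "coeff (p \<otimes>\<^bsub>B [X]\<^esub> q) = (\<lambda>i. \<Oplus>k\<in>{..i}. coeff p k \<otimes> coeff q (i - k))"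
      using p q set_car poly_mult_coeff[of p q] by (simp add: univ_poly_mult)
    have car: "coeff p i \<in> carrier R" "coeff q i \<in> carrier R" for i
      using p q set_car by auto
    have "coeff (p \<otimes>\<^bsub>B [X]\<^esub> q) 0 = coeff p 0 \<otimes> coeff q 0"
      using car by (simp add: mult)
    moreover have "coeff (p \<otimes>\<^bsub>B [X]\<^esub> q) 1 = coeff p 0 \<otimes> coeff q 1 \<oplus> coeff p 1 \<otimes> coeff q 0"
    proof -
      have "{..1::nat} = {0, 1}" by auto
      then show ?thesis using car by (simp add: mult)
    qed
    ultimately show "p \<otimes>\<^bsub>B [X]\<^esub> q \<in> ?C"
      using p q a(6,7) by simp
  qed
  then show "subring (carrier (composite_poly_ring R A B)) (B [X])"
    by (simp add: composite_poly_ring_def)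
  show "domain (composite_poly_ring R A B)"
    using BX.subring_is_domain[OF sub] by (simp add: composite_poly_ring_def)
qed

end

theory Submission
  imports Defs
begin

text \<open>
  In \<open>D = A[x] + B[x]x\<^sup>2\<close> a factor of degree \<open>0\<close> lies in \<open>A\<close>. If \<open>A\<close> is a field, proper
  factorisations therefore lower the degree, and \<open>D\<close> satisfies the ACCP. If \<open>A\<close> only satisfies the
  ACCP, every \<open>p\<close> with \<open>p(0) \<noteq> 0\<close> or \<open>p'(0) \<noteq> 0\<close> is still atomic in \<open>D\<close>, because this property
  passes to factors, and constant factors divide the lowest coefficient of \<open>p\<close> in \<open>A\<close>. In
  particular \<open>x\<close> and the nonzero constants of \<open>D\<close> are atomic. Write \<open>f = x\<^sup>k g\<close> with
  \<open>g(0) \<noteq> 0\<close>. For (2), a nonzero \<open>s\<close> in \<open>S\<close> clears the denominators of the two lowest coefficients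
  of \<open>g\<close>, and \<open>s f = x\<^sup>k (s g)\<close> is atomic. For (3), choose a linear \<open>h\<close> such that \<open>h g\<close> has
  lowest coefficients \<open>1\<close> and \<open>0\<close>; then \<open>x\<^sup>2 h\<close> lies in \<open>D\<close> and
  \<open>x\<^sup>2 h f = x\<^sup>k\<^sup>+\<^sup>2 (h g)\<close> is atomic.
\<close>

subsection \<open>Atomic elements and chain conditions in a domain\<close>

lemma (in domain) unit_mult_atom:
  assumes "u \<in> Units R" "p \<in> atoms R"
  shows "u \<otimes> p \<in> atoms R"
proof -
  have u: "u \<in> carrier R" "inv u \<in> carrier R" "inv u \<otimes> u = \<one>" using assms(1) by auto
  have p: "p \<in> carrier R - {\<zero>}" "p \<notin> Units R"
    and irr: "\<And>b c. \<lbrakk>b \<in> carrier R; c \<in> carrier R; p = b \<otimes> c\<rbrakk> \<Longrightarrow> b \<in> Units R \<or> c \<in> Units R"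
    using assms(2) unfolding atoms_iff by blast+
  have cancel: "inv u \<otimes> (u \<otimes> b) = b" if "b \<in> carrier R" for b
    using u that by (simp add: m_assoc[symmetric])
  have unit: "b \<in> Units R" if "inv u \<otimes> b \<in> Units R" "b \<in> carrier R" for b
  proof -
    have "u \<otimes> (inv u \<otimes> b) = b"
      using assms(1) u that(2) by (simp add: m_assoc[symmetric])
    then show ?thesis using Units_m_closed[OF assms(1) that(1)] by simp
  qed
  have "b \<in> Units R \<or> c \<in> Units R"
    if bc: "b \<in> carrier R" "c \<in> carrier R" "u \<otimes> p = b \<otimes> c" for b c
  proof -
    have "p = (inv u \<otimes> b) \<otimes> c"
      using cancel[of p] bc p(1) u by (simp add: m_assoc)
    then have "inv u \<otimes> b \<in> Units R \<or> c \<in> Units R"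
      by (intro irr m_closed bc u)
    then show ?thesis using unit bc(1) by blast
  qed
  moreover have "u \<otimes> p \<notin> Units R"
    using p cancel[of p] Units_m_closed[OF Units_inv_Units[OF assms(1)], of "u \<otimes> p"] by auto
  moreover have "u \<otimes> p \<in> carrier R - {\<zero>}"
    using p u cancel[of p] by auto
  ultimately show ?thesis unfolding atoms_iff by blast
qed

lemma (in domain) atom_imp_atomic_element:
  assumes "a \<in> atoms R"
  shows "atomic_element R a"
  using assms atoms_iff[of a] unfolding atomic_element_def
  by (auto intro!: exI[of _ "[a]"])

lemma (in domain) atoms_subset_carrier: "atoms R \<subseteq> carrier R"
  by (auto simp: atoms_def)

lemma (in monoid) foldr_mult_append:
  assumes "set ps \<subseteq> carrier G" "set qs \<subseteq> carrier G"
  shows "foldr (\<otimes>) (ps @ qs) \<one> = foldr (\<otimes>) ps \<one> \<otimes> foldr (\<otimes>) qs \<one>"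
proof -
  have closed: "foldr (\<otimes>) rs \<one> \<in> carrier G" if "set rs \<subseteq> carrier G" for rs
    using that by (induction rs) auto
  show ?thesis
    using assms(1) closed[OF assms(2)]
    by (induction ps) (auto simp: m_assoc closed)
qed

text \<open>An atom stays an atom when multiplied by a unit, so the unit is absorbed into the first
  atom of a factorisation.\<close>

lemma (in domain) atomic_element_unit_mult:
  assumes u: "u \<in> Units R" and a: "atomic_element R a"
  shows "atomic_element R (u \<otimes> a)"
proof (cases "a \<in> Units R")
  case True
  then have "u \<otimes> a \<in> Units R" using u by blast
  moreover have "\<zero> \<notin> Units R" by (simp add: Units_def)
  ultimately show ?thesis unfolding atomic_element_def by auto
next
  case False
  then obtain ps where ps: "set ps \<subseteq> atoms R" "a = foldr (\<otimes>) ps \<one>"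
    and a: "a \<in> carrier R - {\<zero>}"
    using a unfolding atomic_element_def by blast
  \<comment> \<open>The empty product is \<open>\<one>\<close>, a unit, so a nonunit has at least
    one atom to absorb \<open>u\<close>.\<close>
  then obtain p qs where eq: "ps = p # qs" using False by (cases ps) auto
  have car: "set qs \<subseteq> carrier R" "p \<in> carrier R" "u \<in> carrier R"
    using ps eq atoms_subset_carrier u by auto
  then have "foldr (\<otimes>) qs \<one> \<in> carrier R" by (induction qs) auto
  then have "u \<otimes> a = foldr (\<otimes>) ((u \<otimes> p) # qs) \<one>"
    using ps eq car by (simp add: m_assoc)
  moreover have "set ((u \<otimes> p) # qs) \<subseteq> atoms R"
    using ps eq unit_mult_atom[OF u] by simp
  moreover have "u \<otimes> a \<in> carrier R - {\<zero>}"
    using a car u integral[of u a] by (auto simp: Units_def)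
  ultimately show ?thesis unfolding atomic_element_def by blast
qed

lemma (in domain) atomic_element_mult:
  assumes a: "atomic_element R a" and b: "atomic_element R b"
  shows "atomic_element R (a \<otimes> b)"
proof (cases "a \<in> Units R \<or> b \<in> Units R")
  case True
  then show ?thesis
    using atomic_element_unit_mult[of a b] atomic_element_unit_mult[of b a] a b
      m_comm[of a b] by (auto simp: atomic_element_def)
next
  case False
  obtain ps qs where "set ps \<subseteq> atoms R" "a = foldr (\<otimes>) ps \<one>"
    "set qs \<subseteq> atoms R" "b = foldr (\<otimes>) qs \<one>"
    using False a b unfolding atomic_element_def by blast
  then have "set (ps @ qs) \<subseteq> atoms R" "a \<otimes> b = foldr (\<otimes>) (ps @ qs) \<one>"
    using foldr_mult_append[of ps qs] atoms_subset_carrier by auto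
  moreover have "a \<otimes> b \<in> carrier R - {\<zero>}"
    using a b integral[of a b] by (auto simp: atomic_element_def)
  ultimately show ?thesis unfolding atomic_element_def by blast
qed

text \<open>Split a nonunit that is not an atom into two nonunits. Both factors stay in
  \<open>P\<close> and have smaller measure \<open>m\<close>, so both are atomic by induction.
  Working in a factor-closed set \<open>P\<close> gives atomicity of some elements in a ring that
  need not be atomic.\<close>

lemma (in domain) atomic_element_wf_induct:
  assumes wf: "wf r"
    and sub: "P \<subseteq> carrier R - {\<zero>}"
    and factor: "\<And>b c. \<lbrakk>b \<in> carrier R; c \<in> carrier R; b \<otimes> c \<in> P\<rbrakk> \<Longrightarrow> b \<in> P"
    and decr: "\<And>b c. \<lbrakk>b \<otimes> c \<in> P; b \<in> P; c \<in> carrier R - Units R\<rbrakk> \<Longrightarrow> (m b, m (b \<otimes> c)) \<in> r"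
    and a: "a \<in> P"
  shows "atomic_element R a"
  using wf_inv_image[OF wf, of m] a
proof (induction a rule: wf_induct_rule)
  case (less a)
  consider "a \<in> Units R" | "a \<in> atoms R"
    | b c where "b \<in> carrier R - Units R" "c \<in> carrier R - Units R" "a = b \<otimes> c"
    using less.prems sub atoms_iff[of a] by blast
  then show ?case
  proof cases
    case 1
    then show ?thesis using less.prems sub unfolding atomic_element_def by blast
  next
    case 2
    then show ?thesis by (rule atom_imp_atomic_element)
  next
    case 3
    \<comment> \<open>\<open>factor\<close> and \<open>decr\<close> speak of the left factor only;
      swapping the factors covers \<open>c\<close>.\<close>
    then have a': "a = c \<otimes> b" by (simp add: m_comm)
    have P: "b \<in> P" "c \<in> P"
      using 3 a' less.prems factor[of b c] factor[of c b] by auto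
    have "(b, a) \<in> inv_image r m" "(c, a) \<in> inv_image r m"
      using decr[of b c] decr[of c b] 3 a' P less.prems by auto
    then show ?thesis using less.IH P 3(3) atomic_element_mult by simp
  qed
qed

section \<open>Well-founded measures and the ACCP\<close>

text \<open>In an ascending chain each generator divides the earlier ones. Once a nonzero generator
  has minimal measure, every later cofactor must be a unit, so the ideals agree from there
  on.\<close>

lemma (in domain) ACCP_if_wf:
  assumes wf: "wf r"
    and decr: "\<And>b c. \<lbrakk>b \<in> carrier R - {\<zero>}; c \<in> carrier R - {\<zero>}; c \<notin> Units R\<rbrakk>
      \<Longrightarrow> (m b, m (b \<otimes> c)) \<in> r"
  shows "ACCP R"
  unfolding ACCP_def
proof (intro allI impI)
  fix I :: "nat \<Rightarrow> 'a set"
  assume I: "(\<forall>n. principalideal (I n) R) \<and> (\<forall>n. I n \<subseteq> I (Suc n))"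
  then have "\<forall>n. \<exists>g. g \<in> carrier R \<and> I n = PIdl g"
    using principalideal.generate[of _ R] cgenideal_eq_genideal by fastforce
  then obtain g where g: "\<And>n. g n \<in> carrier R" "\<And>n. I n = PIdl (g n)" by metis
  have mono: "I m \<subseteq> I n" if "m \<le> n" for m n
    using that I lift_Suc_mono_le[of I] by blast
  have dvd: "g n divides g m" if "m \<le> n" for m n
    using mono[OF that] g to_contain_is_to_divide by auto
  show "\<exists>N. \<forall>n\<ge>N. I n = I N"
  proof (cases "\<forall>n. g n = \<zero>")
    case True
    then show ?thesis using g(2) by auto
  next
    case False
    then obtain N where N: "g N \<noteq> \<zero>" by blast
    \<comment> \<open>Later generators divide \<open>g N\<close>, and zero divides only
      zero.\<close>
    have nz: "g n \<noteq> \<zero>" if "n \<ge> N" for n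
      using dvd[OF that] N by (auto elim!: dividesE)
    obtain z where z: "z \<in> (m \<circ> g) ` {N..}" and min: "\<And>y. (y, z) \<in> r \<Longrightarrow> y \<notin> (m \<circ> g) ` {N..}"
      using wfE_min[OF wf, of _ "(m \<circ> g) ` {N..}"] by blast
    then obtain M where M: "M \<ge> N" "z = m (g M)" by auto
    have "I n = I M" if n: "n \<ge> M" for n
    proof -
      obtain c where c: "c \<in> carrier R" "g M = g n \<otimes> c"
        using dvd[OF n] by (auto elim: dividesE)
      have "c \<noteq> \<zero>" using c nz[OF M(1)] g(1) by auto
      moreover have "(m (g n), m (g M)) \<notin> r"
        using min[of "m (g n)"] M n by auto
      ultimately have "c \<in> Units R"
        using decr[of "g n" c] c g(1) nz[of n] n M(1) by auto
      then have "g M \<sim> g n"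
        using c g(1) associatedI2' by blast
      then show ?thesis using associated_iff_same_ideal g by simp
    qed
    then show ?thesis by blast
  qed
qed

text \<open>An infinite sequence of successive proper factors would generate an ascending chain of
  principal ideals. Where the chain stabilises, two neighbours divide each other, so the factor is
  not proper.\<close>

lemma (in domain) ACCP_imp_wf:
  assumes "ACCP R"
  shows "wf {(b, a). b \<in> carrier R \<and> a \<in> carrier R \<and> properfactor R b a}"
  unfolding wf_iff_no_infinite_down_chain
proof
  assume "\<exists>g. \<forall>i. (g (Suc i), g i) \<in> {(b, a). b \<in> carrier R \<and> a \<in> carrier R \<and> properfactor R b a}"
  then obtain g where g: "\<And>i. g i \<in> carrier R" "\<And>i. properfactor R (g (Suc i)) (g i)" by blast
  have "principalideal (PIdl (g n)) R" for n
    using g(1) by (rule cgenideal_is_principalideal)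
  moreover have "PIdl (g n) \<subseteq> PIdl (g (Suc n))" for n
    using to_contain_is_to_divide[OF g(1) g(1)] properfactor_divides[OF g(2)] by simp
  ultimately obtain N where "\<forall>n\<ge>N. PIdl (g n) = PIdl (g N)"
    using assms[unfolded ACCP_def, THEN spec, of "\<lambda>n. PIdl (g n)"] by blast
  then have "PIdl (g (Suc N)) = PIdl (g N)" by (meson le_SucI order_refl)
  then have "g N divides g (Suc N)"
    using to_contain_is_to_divide[OF g(1) g(1), of "Suc N" N] by blast
  then show False using g(2)[of N] by (auto simp: properfactor_def)
qed

subsection \<open>The ring \<open>A[x] + B[x]x\<^sup>2\<close>\<close>

locale composite_poly = domain R for R :: "('a, 'b) ring_scheme" (structure) +
  fixes A B :: "'a set"
  assumes A: "subring A R" and B: "subring B R" and A_sub_B: "A \<subseteq> B"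
begin

abbreviation (input) P where "P \<equiv> B [X]\<^bsub>R\<^esub>"
abbreviation (input) D where "D \<equiv> composite_poly_ring R A B"

lemma D_simps [simp]:
  "mult D = mult P" "one D = one P" "zero D = []"
  "p \<in> carrier D \<longleftrightarrow> p \<in> carrier P \<and> coeff p 0 \<in> A \<and> coeff p 1 \<in> A"
  by (simp_all add: composite_poly_ring_def univ_poly_zero)

lemma set_poly:
  assumes "p \<in> carrier P"
  shows "set p \<subseteq> B" and "set p \<subseteq> carrier R"
proof -
  show "set p \<subseteq> B"
    using assms polynomial_incl univ_poly_carrier by blast
  then show "set p \<subseteq> carrier R" using subringE(1)[OF B] by blast
qed

lemma coeff_closed:
  assumes "p \<in> carrier P"
  shows "coeff p i \<in> B" and "coeff p i \<in> carrier R"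
proof -
  \<comment> \<open>Besides the entries of the list, \<open>coeff\<close> takes only the default
    value \<open>\<zero>\<close>, which lies in \<open>B\<close>.\<close>
  show "coeff p i \<in> B"
    using rangeI[of "coeff p" i] set_poly(1)[OF assms] subringE(2)[OF B]
    unfolding coeff_img(3) by auto
  then show "coeff p i \<in> carrier R" using subringE(1)[OF B] by blast
qed

lemma coeff_mult:
  assumes p: "p \<in> carrier P" and q: "q \<in> carrier P"
  shows "coeff (p \<otimes>\<^bsub>P\<^esub> q) 0 = coeff p 0 \<otimes> coeff q 0"
    and "coeff (p \<otimes>\<^bsub>P\<^esub> q) 1 = coeff p 0 \<otimes> coeff q 1 \<oplus> coeff p 1 \<otimes> coeff q 0"
proof -
  have mult: "coeff (p \<otimes>\<^bsub>P\<^esub> q) = (\<lambda>i. \<Oplus>k\<in>{..i}. coeff p k \<otimes> coeff q (i - k))"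
    using poly_mult_coeff[OF set_poly(2)[OF p] set_poly(2)[OF q]] by (simp add: univ_poly_mult)
  show "coeff (p \<otimes>\<^bsub>P\<^esub> q) 0 = coeff p 0 \<otimes> coeff q 0"
    using coeff_closed[OF p] coeff_closed[OF q] by (simp add: mult)
  have "{..1::nat} = {0, 1}" by auto
  then show "coeff (p \<otimes>\<^bsub>P\<^esub> q) 1 = coeff p 0 \<otimes> coeff q 1 \<oplus> coeff p 1 \<otimes> coeff q 0"
    using coeff_closed[OF p] coeff_closed[OF q] by (simp add: mult)
qed

text \<open>The zero polynomial \<open>[]\<close> has \<open>degree\<close> 0 in this
  representation, so additivity would fail for it.\<close>

lemma degree_mult:
  assumes "p \<in> carrier P - {[]}" and "q \<in> carrier P - {[]}"
  shows "degree (p \<otimes>\<^bsub>P\<^esub> q) = degree p + degree q"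
  using assms poly_mult_degree_eq[OF B, of p q]
  by (simp add: univ_poly_mult univ_poly_carrier)

lemma const_closed: "s \<in> B - {\<zero>} \<Longrightarrow> [s] \<in> carrier P"
  using const_is_polynomial univ_poly_carrier by blast

lemma degree_0_const:
  assumes "p \<in> carrier P" "p \<noteq> []" "degree p = 0"
  obtains s where "p = [s]" "s \<in> B - {\<zero>}"
proof -
  obtain s where s: "p = [s]" using assms(2,3) by (cases p) auto
  then have "s \<in> B - {\<zero>}"
    using assms(1) lead_coeff_not_zero[of B s "[]"] univ_poly_carrier by blast
  then show thesis using that s by blast
qed

lemma const_mult:
  assumes "s \<in> B - {\<zero>}" "t \<in> B - {\<zero>}"
  shows "[s] \<otimes>\<^bsub>P\<^esub> [t] = [s \<otimes> t]"
  using poly_mult_const(1)[OF B _ assms(1), of "[t]"] const_closed[OF assms(2)]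
  by (simp add: univ_poly_mult univ_poly_carrier)

text \<open>Used in contrapositive form: a constant that is a nonunit of \<open>D\<close> has no
  inverse in \<open>A\<close>.\<close>

lemma const_in_Units:
  assumes "s \<in> A" "t \<in> A" "s \<otimes> t = \<one>"
  shows "[s] \<in> Units D"
proof -
  have car: "s \<in> carrier R" "t \<in> carrier R" using assms subringE(1)[OF A] by auto
  then have "s \<noteq> \<zero>" "t \<noteq> \<zero>" using assms(3) by auto
  then have nz: "s \<in> B - {\<zero>}" "t \<in> B - {\<zero>}" using assms(1,2) A_sub_B by auto
  have ts: "t \<otimes> s = \<one>" using assms(3) car m_comm by simp
  have "[s] \<in> carrier D" "[t] \<in> carrier D"
    using assms const_closed[OF nz(1)] const_closed[OF nz(2)] subringE(2)[OF A] by simp_all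
  moreover have "[s] \<otimes>\<^bsub>P\<^esub> [t] = \<one>\<^bsub>P\<^esub>" "[t] \<otimes>\<^bsub>P\<^esub> [s] = \<one>\<^bsub>P\<^esub>"
    using assms(3) ts const_mult[OF nz] const_mult[OF nz(2,1)] by (simp_all add: univ_poly_one)
  ultimately show ?thesis unfolding Units_def by auto
qed

lemma X_closed: "X \<in> carrier P"
  using var_closed(1)[OF B] .

lemma coeff_X: "coeff X 0 = \<zero>" "coeff X 1 = \<one>"
  by (simp_all add: var_def)

lemma X_in_D: "X \<in> carrier D"
  using X_closed coeff_X subringE(2,3)[OF A] by simp

end

sublocale composite_poly \<subseteq> P: domain P
  by (rule univ_poly_is_domain[OF B])

sublocale composite_poly \<subseteq> D: domain D
  by (rule composite_poly_ring_subring(2)[OF A B])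

context composite_poly
begin

section \<open>Elements with a nonzero coefficient in degree 0 or 1\<close>

text \<open>The measure is lexicographic: first the degree, then the lowest nonzero coefficient
  under proper divisibility in \<open>A\<close>, which is well-founded by the ACCP. A nonconstant
  cofactor lowers the degree; a constant nonunit cofactor keeps the degree and lowers the
  coefficient.\<close>

lemma atomic_element_if_low_coeff:
  assumes accp: "ACCP (R\<lparr>carrier := A\<rparr>)"
    and p: "p \<in> carrier D" "coeff p 0 \<noteq> \<zero> \<or> coeff p 1 \<noteq> \<zero>"
  shows "atomic_element D p"
proof -
  let ?A = "R\<lparr>carrier := A\<rparr>"
  interpret A: domain ?A using subring_is_domain[OF A] .
  define low where "low q = (if coeff q 0 \<noteq> \<zero> then coeff q 0 else coeff q 1)" for q
  define Q where "Q = {q \<in> carrier D. coeff q 0 \<noteq> \<zero> \<or> coeff q 1 \<noteq> \<zero>}"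
  define r where "r = {(b, a). b \<in> carrier ?A \<and> a \<in> carrier ?A \<and> properfactor ?A b a}"
  have "wf r" unfolding r_def using A.ACCP_imp_wf[OF accp] .
  then have wf: "wf (less_than <*lex*> r)" by auto
  show ?thesis
  proof (rule D.atomic_element_wf_induct[OF wf, where P = Q and m = "\<lambda>q. (degree q, low q)"])
    show "p \<in> Q" using p by (simp add: Q_def)
    show "Q \<subseteq> carrier D - {\<zero>\<^bsub>D\<^esub>}" by (auto simp: Q_def)
  next
    fix b c assume b: "b \<in> carrier D" and c: "c \<in> carrier D" and bc: "b \<otimes>\<^bsub>D\<^esub> c \<in> Q"
    \<comment> \<open>If both low coefficients of \<open>b\<close> vanished, so would those of the
      product.\<close>
    then have "\<not> (coeff b 0 = \<zero> \<and> coeff b 1 = \<zero>)"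
      using coeff_mult[of b c] coeff_closed(2)[of c] by (auto simp: Q_def)
    then show "b \<in> Q" using b by (auto simp: Q_def)
  next
    fix b c
    assume bc: "b \<otimes>\<^bsub>D\<^esub> c \<in> Q" and b: "b \<in> Q" and c: "c \<in> carrier D - Units D"
    have bP: "b \<in> carrier P - {[]}" using b by (auto simp: Q_def)
    have "c \<noteq> []" using bc bP P.r_null[of b] by (auto simp: Q_def univ_poly_zero)
    then have cP: "c \<in> carrier P - {[]}" using c by simp
    show "((degree b, low b), (degree (b \<otimes>\<^bsub>D\<^esub> c), low (b \<otimes>\<^bsub>D\<^esub> c))) \<in> less_than <*lex*> r"
    proof (cases "degree c = 0")
      case False
      then have "degree b < degree (b \<otimes>\<^bsub>D\<^esub> c)"
        unfolding D_simps degree_mult[OF bP cP] by linarith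
      then show ?thesis by simp
    next
      case True
      then obtain s where s: "c = [s]" "s \<in> B - {\<zero>}" using degree_0_const cP by blast
      \<comment> \<open>A constant in \<open>D\<close> is its own coefficient of degree 0, hence
        lies in \<open>A\<close> and not merely in \<open>B\<close>.\<close>
      have sA: "s \<in> A" using c s by simp
      then have s_car: "s \<in> carrier R" using subringE(1)[OF A] by blast
      have b_car: "coeff b i \<in> carrier R" for i using coeff_closed(2) bP by blast
      have cf: "coeff (b \<otimes>\<^bsub>P\<^esub> c) 0 = coeff b 0 \<otimes> s" "coeff (b \<otimes>\<^bsub>P\<^esub> c) 1 = coeff b 1 \<otimes> s"
        using coeff_mult[of b c] bP cP s s_car b_car by simp_all
      \<comment> \<open>Since \<open>s\<close> is nonzero, scaling does not change which of the two
        coefficients \<open>low\<close> selects.\<close>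
      have low_mult: "low (b \<otimes>\<^bsub>P\<^esub> c) = low b \<otimes> s"
        using cf b_car s s_car integral[of "coeff b 0" s] by (auto simp: low_def)
      have low_A: "low b \<in> A" "low b \<noteq> \<zero>" using b by (auto simp: low_def Q_def)
      \<comment> \<open>Otherwise cancelling \<open>low b\<close> would give \<open>s\<close> an
        inverse in \<open>A\<close>, making \<open>c\<close> a unit of \<open>D\<close>.\<close>
      have "\<not> low b \<otimes> s divides\<^bsub>?A\<^esub> low b"
      proof
        assume "low b \<otimes> s divides\<^bsub>?A\<^esub> low b"
        then obtain t where t: "t \<in> A" "low b = low b \<otimes> s \<otimes> t" by (auto elim!: dividesE)
        then have t_car: "t \<in> carrier R" "low b \<in> carrier R"
          using low_A subringE(1)[OF A] by auto
        then have "low b \<otimes> (s \<otimes> t) = low b \<otimes> \<one>"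
          using t s_car by (simp add: m_assoc)
        then have "s \<otimes> t = \<one>"
          using m_lcancel[of "low b" "s \<otimes> t" \<one>] low_A t_car s_car by simp
        then show False using const_in_Units[OF sA t(1)] s c by simp
      qed
      moreover have "low b divides\<^bsub>?A\<^esub> low b \<otimes> s"
        using sA by (auto simp: factor_def)
      ultimately have "(low b, low b \<otimes> s) \<in> r"
        using low_A sA subringE(6)[OF A] by (simp add: r_def properfactor_def)
      then show ?thesis
        using low_mult degree_mult[OF bP cP] True by simp
    qed
  qed
qed

section \<open>ACCP and atomicity over a subfield\<close>

text \<open>Nonzero constants of \<open>D\<close> lie in the field \<open>A\<close> and are units,
  so every nonzero nonunit has positive degree. The degree is thus a measure for both
  well-foundedness criteria.\<close>

lemma ACCP_and_atomic_if_subfield: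
  assumes "subfield A R"
  shows "ACCP D" and "atomic_ring D"
proof -
  have deg: "(degree b, degree (b \<otimes>\<^bsub>D\<^esub> c)) \<in> less_than"
    if bc: "b \<in> carrier D - {\<zero>\<^bsub>D\<^esub>}" "c \<in> carrier D - {\<zero>\<^bsub>D\<^esub>}" "c \<notin> Units D" for b c
  proof -
    have "degree c \<noteq> 0"
    proof
      assume "degree c = 0"
      then obtain s where s: "c = [s]" "s \<noteq> \<zero>" using degree_0_const[of c] bc by auto
      then have sA: "s \<in> A" using bc by simp
      then have "inv s \<in> A" "s \<otimes> inv s = \<one>"
        using subfield_m_inv[OF assms, of s] s by auto
      then show False using const_in_Units[OF sA] s bc by blast
    qed
    then show ?thesis using degree_mult[of b c] bc by simp
  qed
  show "ACCP D" using D.ACCP_if_wf[OF wf_less_than, of degree] deg by blast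
  show "atomic_ring D"
    unfolding atomic_ring_def
  proof
    fix a assume a: "a \<in> carrier D - {\<zero>\<^bsub>D\<^esub>}"
    show "atomic_element D a"
    proof (rule D.atomic_element_wf_induct[OF wf_less_than,
          where P = "carrier D - {\<zero>\<^bsub>D\<^esub>}" and m = degree])
      show "a \<in> carrier D - {\<zero>\<^bsub>D\<^esub>}" by (fact a)
    next
      fix b c assume "b \<in> carrier D" "c \<in> carrier D" "b \<otimes>\<^bsub>D\<^esub> c \<in> carrier D - {\<zero>\<^bsub>D\<^esub>}"
      then show "b \<in> carrier D - {\<zero>\<^bsub>D\<^esub>}" using D.l_null[of c] by blast
    next
      fix b c
      assume bc: "b \<otimes>\<^bsub>D\<^esub> c \<in> carrier D - {\<zero>\<^bsub>D\<^esub>}" "b \<in> carrier D - {\<zero>\<^bsub>D\<^esub>}"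
        "c \<in> carrier D - Units D"
      then have "c \<noteq> \<zero>\<^bsub>D\<^esub>" using D.r_null[of b] by blast
      then show "(degree b, degree (b \<otimes>\<^bsub>D\<^esub> c)) \<in> less_than" using deg bc by blast
    qed blast
  qed
qed

section \<open>Multiples that are atomic\<close>

lemma atomic_element_X:
  assumes "ACCP (R\<lparr>carrier := A\<rparr>)"
  shows "atomic_element D X"
  using atomic_element_if_low_coeff[OF assms X_in_D] coeff_X by simp

text \<open>The quotients by powers of \<open>x\<close> need not lie in \<open>D\<close>, so \<open>f\<close> ranges over all of \<open>B[x]\<close>.\<close>

lemma atomic_multiple_if_nonzero_const_coeff:
  assumes accp: "ACCP (R\<lparr>carrier := A\<rparr>)"
    and T: "T \<subseteq> carrier P"
    and base: "\<And>g. \<lbrakk>g \<in> carrier P; coeff g 0 \<noteq> \<zero>\<rbrakk> \<Longrightarrow> \<exists>a\<in>T. atomic_element D (a \<otimes>\<^bsub>P\<^esub> g)"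
    and f: "f \<in> carrier P - {[]}"
  shows "\<exists>a\<in>T. atomic_element D (a \<otimes>\<^bsub>P\<^esub> f)"
  using f
proof (induction "length f" arbitrary: f rule: less_induct)
  case less
  show ?case
  proof (cases "coeff f 0 = \<zero>")
    case False
    then show ?thesis using base less.prems by blast
  next
    case True
    \<comment> \<open>Lists start with the leading coefficient, so the constant one comes last;
      dropping it divides by \<open>X\<close>.\<close>
    define g where "g = butlast f"
    have "last f = \<zero>"
      using True less.prems coeff_nth[of 0 f] by (simp add: last_conv_nth)
    then have f: "f = g @ [\<zero>]"
      using less.prems append_butlast_last_id[of f] by (simp add: g_def)
    have pf: "polynomial B f" using less.prems univ_poly_carrier by blast
    \<comment> \<open>If \<open>g\<close> were empty, \<open>f\<close> would be
      \<open>[\<zero>]\<close>, which has a zero leading entry and is no polynomial.\<close>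
    then have g_nz: "g \<noteq> []" using f by (auto simp: polynomial_def)
    then have "polynomial B g" using pf f by (auto simp: polynomial_def)
    then have g: "g \<in> carrier P" using univ_poly_carrier by blast
    have fX: "f = X \<otimes>\<^bsub>P\<^esub> g"
      using poly_mult_var[OF B g] g_nz f P.m_comm[OF g X_closed] by simp
    obtain a where a: "a \<in> T" "atomic_element D (a \<otimes>\<^bsub>P\<^esub> g)"
      using less.hyps[of g] g g_nz f by auto
    \<comment> \<open>The multiplier found for \<open>g\<close> also serves \<open>f\<close>, with
      one more atomic factor \<open>X\<close>.\<close>
    have "a \<otimes>\<^bsub>P\<^esub> f = X \<otimes>\<^bsub>P\<^esub> (a \<otimes>\<^bsub>P\<^esub> g)"
      unfolding fX using P.m_lcomm[of a X g] a(1) T g X_closed by blast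
    moreover have "atomic_element D (X \<otimes>\<^bsub>P\<^esub> (a \<otimes>\<^bsub>P\<^esub> g))"
      using D.atomic_element_mult[OF atomic_element_X[OF accp] a(2)] by simp
    ultimately have "atomic_element D (a \<otimes>\<^bsub>P\<^esub> f)" by (rule ssubst)
    then show ?thesis using a(1) by blast
  qed
qed

text \<open>A constant multiplier clears the denominators of the two coefficients that must lie in
  \<open>A\<close>. It is itself atomic, since its coefficient in degree 0 is nonzero.\<close>

lemma almost_atomic_if_denominators:
  assumes accp: "ACCP (R\<lparr>carrier := A\<rparr>)"
    and denom: "\<And>z. z \<in> B \<Longrightarrow> \<exists>s\<in>A - {\<zero>}. s \<otimes> z \<in> A"
  shows "almost_atomic D"
  unfolding almost_atomic_def
proof
  fix f assume f: "f \<in> carrier D - {\<zero>\<^bsub>D\<^esub>}"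
  define T where "T = {[s] | s. s \<in> A - {\<zero>}}"
  have T_P: "T \<subseteq> carrier P" using A_sub_B const_closed by (auto simp: T_def)
  have "\<exists>a\<in>T. atomic_element D (a \<otimes>\<^bsub>P\<^esub> g)" if g: "g \<in> carrier P" "coeff g 0 \<noteq> \<zero>" for g
  proof -
    obtain s t where s: "s \<in> A - {\<zero>}" "s \<otimes> coeff g 0 \<in> A"
      and t: "t \<in> A - {\<zero>}" "t \<otimes> coeff g 1 \<in> A"
      using denom coeff_closed(1)[OF g(1)] by meson
    have car: "s \<in> carrier R" "t \<in> carrier R" "coeff g i \<in> carrier R" for i
      using s t subringE(1)[OF A] coeff_closed(2)[OF g(1)] by auto
    \<comment> \<open>The product is a common denominator for the coefficients of degrees 0 and
      1.\<close>
    have st: "s \<otimes> t \<in> A - {\<zero>}" using s t car integral[of s t] subringE(6)[OF A] by auto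
    then have stT: "[s \<otimes> t] \<in> T" by (auto simp: T_def)
    have cf: "coeff ([s \<otimes> t] \<otimes>\<^bsub>P\<^esub> g) 0 = t \<otimes> (s \<otimes> coeff g 0)"
      "coeff ([s \<otimes> t] \<otimes>\<^bsub>P\<^esub> g) 1 = s \<otimes> (t \<otimes> coeff g 1)"
      using coeff_mult[of "[s \<otimes> t]" g] stT T_P g car by (auto simp: m_ac)
    have "[s \<otimes> t] \<otimes>\<^bsub>P\<^esub> g \<in> carrier D"
      using cf s t subringE(6)[OF A] stT T_P g by auto
    moreover have "coeff ([s \<otimes> t] \<otimes>\<^bsub>P\<^esub> g) 0 \<noteq> \<zero>"
      using cf s t g car integral by (metis DiffD2 m_closed singletonI)
    ultimately show ?thesis using atomic_element_if_low_coeff[OF accp] stT by blast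
  qed
  then obtain s where s: "s \<in> A - {\<zero>}" "atomic_element D ([s] \<otimes>\<^bsub>P\<^esub> f)"
    using atomic_multiple_if_nonzero_const_coeff[OF accp T_P] f by (force simp: T_def)
  have sD: "[s] \<in> carrier D"
    using s const_closed A_sub_B subringE(2)[OF A] by auto
  moreover have "atomic_element D [s]"
    using atomic_element_if_low_coeff[OF accp sD] s by simp
  ultimately show "\<exists>a\<in>carrier D. atomic_element D a \<and> atomic_element D (a \<otimes>\<^bsub>D\<^esub> f)"
    using s by auto
qed

lemma quasi_atomic_if_subfield:
  assumes accp: "ACCP (R\<lparr>carrier := A\<rparr>)"
    and field: "subfield B R"
  shows "quasi_atomic D"
  unfolding quasi_atomic_def
proof
  fix f assume f: "f \<in> carrier D - {\<zero>\<^bsub>D\<^esub>}"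
  have "\<exists>a\<in>carrier P. atomic_element D (a \<otimes>\<^bsub>P\<^esub> g)"
    if g: "g \<in> carrier P" "coeff g 0 \<noteq> \<zero>" for g
  proof -
    \<comment> \<open>With \<open>c\<close> and \<open>d\<close> chosen this way,
      \<open>c - d x\<close> is the inverse of \<open>g\<close> modulo \<open>x^2\<close>.
      \<open>normalize\<close> is needed because \<open>d\<close> may be zero.\<close>
    define c where "c = inv (coeff g 0)"
    define d where "d = coeff g 1 \<otimes> c \<otimes> c"
    define h where "h = normalize [\<ominus> d, c]"
    have car: "coeff g i \<in> carrier R" for i using coeff_closed(2)[OF g(1)] .
    have c: "c \<in> B" "c \<otimes> coeff g 0 = \<one>"
      using subfield_m_inv[OF field, of "coeff g 0"] coeff_closed(1)[OF g(1)] g(2)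
      by (auto simp: c_def)
    then have c_car: "c \<in> carrier R" using subringE(1)[OF B] by blast
    have d: "\<ominus> d \<in> B" "d \<in> carrier R"
      using c coeff_closed(1)[OF g(1)] subringE(5,6)[OF B] c_car car by (auto simp: d_def)
    have "polynomial B h"
      unfolding h_def using c d by (intro normalize_gives_polynomial) simp
    then have h: "h \<in> carrier P" using univ_poly_carrier by blast
    have "coeff h = coeff [\<ominus> d, c]" unfolding h_def by (rule normalize_coeff[symmetric])
    then have cfh: "coeff h 0 = c" "coeff h 1 = \<ominus> d" by simp_all
    have dc: "d \<otimes> coeff g 0 = coeff g 1 \<otimes> c"
      using c c_car car by (simp add: d_def m_assoc)
    have cf: "coeff (h \<otimes>\<^bsub>P\<^esub> g) 0 = \<one>" "coeff (h \<otimes>\<^bsub>P\<^esub> g) 1 = \<zero>"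
      using coeff_mult[OF h g(1)] cfh c(2) dc m_comm[OF c_car car[of 1]] c_car d(2) car
      by (simp_all add: l_minus r_neg)
    then have "h \<otimes>\<^bsub>P\<^esub> g \<in> carrier D" using subringE(2,3)[OF A] h g by simp
    then have "atomic_element D (h \<otimes>\<^bsub>P\<^esub> g)"
      using atomic_element_if_low_coeff[OF accp] cf by simp
    then show ?thesis using h by blast
  qed
  then obtain a where a: "a \<in> carrier P" "atomic_element D (a \<otimes>\<^bsub>P\<^esub> f)"
    using atomic_multiple_if_nonzero_const_coeff[OF accp subset_refl] f by force
  \<comment> \<open>The multiplier \<open>a\<close> lies only in \<open>B[x]\<close>; the factor
    \<open>x^2\<close> moves it into \<open>D\<close> and adds two atomic factors to the
    product.\<close>
  define b where "b = X \<otimes>\<^bsub>P\<^esub> (X \<otimes>\<^bsub>P\<^esub> a)"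
  have bP: "b \<in> carrier P" using a X_closed by (simp add: b_def)
  have Xa: "X \<otimes>\<^bsub>P\<^esub> a \<in> carrier P" using a X_closed by simp
  have "coeff b 0 = \<zero>" "coeff b 1 = \<zero>"
    using coeff_mult[OF X_closed Xa] coeff_mult[OF X_closed a(1)] coeff_X
      coeff_closed(2)[OF a(1)] coeff_closed(2)[OF Xa] by (simp_all add: b_def)
  then have bD: "b \<in> carrier D" using bP subringE(2)[OF A] by simp
  have "b \<otimes>\<^bsub>P\<^esub> f = X \<otimes>\<^bsub>P\<^esub> (X \<otimes>\<^bsub>P\<^esub> (a \<otimes>\<^bsub>P\<^esub> f))"
    using a f X_closed by (simp add: b_def P.m_assoc)
  then have bf: "atomic_element D (b \<otimes>\<^bsub>D\<^esub> f)"
    using D.atomic_element_mult[OF atomic_element_X[OF accp]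
        D.atomic_element_mult[OF atomic_element_X[OF accp] a(2)]] by simp
  \<comment> \<open>Atomic elements are nonzero, so \<open>b f\<close> and hence \<open>b\<close> is
    nonzero.\<close>
  then have "b \<noteq> \<zero>\<^bsub>D\<^esub>"
    using D.l_null[of f] f by (auto simp: atomic_element_def)
  then show "\<exists>a\<in>carrier D - {\<zero>\<^bsub>D\<^esub>}. atomic_element D (a \<otimes>\<^bsub>D\<^esub> f)"
    using bD bf by blast
qed

end

theorem proposition3p5:
  fixes K :: "('a, 'b) ring_scheme" and S F :: "'a set"
  assumes "field K"
    and "subdomain S K"
    and "F = quotient_field K S"
    and "ACCP (K\<lparr>carrier := S\<rparr>)"
  shows "(ACCP (composite_poly_ring K F (carrier K)) \<and>
          atomic_ring (composite_poly_ring K F (carrier K))) \<and>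
         almost_atomic (composite_poly_ring K S F) \<and>
         quasi_atomic (composite_poly_ring K S (carrier K))"
proof -
  interpret field K by fact
  have F: "subfield F K" "S \<subseteq> F"
    using quotient_field_subfield[OF assms(2)] assms(3) by auto
  have S: "subring S K" using assms(2) by (auto intro: subcring.axioms(1) subdomain.axioms(1))
  note sub = subfieldE(1)[OF F(1)] carrier_is_subring subfieldE(3)[OF F(1)] subringE(1)[OF S]
  interpret FK: composite_poly K F "carrier K"
    by (intro composite_poly.intro composite_poly_axioms.intro domain_axioms sub)
  interpret SF: composite_poly K S F
    by (intro composite_poly.intro composite_poly_axioms.intro domain_axioms sub S F(2))
  interpret SK: composite_poly K S "carrier K"
    by (intro composite_poly.intro composite_poly_axioms.intro domain_axioms sub S)
  \<comment> \<open>The denominator of a fraction representing \<open>z\<close> serves as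
    \<open>s\<close>.\<close>
  have "\<exists>s\<in>S - {\<zero>\<^bsub>K\<^esub>}. s \<otimes>\<^bsub>K\<^esub> z \<in> S" if "z \<in> F" for z
  proof -
    obtain a b where ab: "a \<in> S" "b \<in> S - {\<zero>\<^bsub>K\<^esub>}" "z = a \<otimes>\<^bsub>K\<^esub> inv\<^bsub>K\<^esub> b"
      using \<open>z \<in> F\<close> assms(3) by (auto simp: quotient_field_def)
    then have "a \<in> carrier K" "b \<in> Units K" using sub(4) field_Units by auto
    then have "b \<otimes>\<^bsub>K\<^esub> z = a"
      using ab(3) m_lcomm[of b a "inv\<^bsub>K\<^esub> b"] Units_closed[of b] by simp
    then show ?thesis using ab by blast
  qed
  then show ?thesis
    using FK.ACCP_and_atomic_if_subfield[OF F(1)] SF.almost_atomic_if_denominators[OF assms(4)]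
      SK.quasi_atomic_if_subfield[OF assms(4) carrier_is_subfield] by blast
qed

end
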